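(* Let $G$ be a directed graph, and let $w\in G^0$ be a sink that is not a source. For each category $\mathsf{C}$ with nonempty coproducts there is an equivalence of categories $$\mathsf{Diag}^{\sqcup}_{\mathsf{C}}(G)\cong \mathsf{Diag}^{\sqcup}_{\mathsf{C}}(G-w).$$ If in addition $w$ is not an infinite receiver, then the same is true for all categories $\mathsf{C}$ with binary coproducts.
   Context: A directed graph $G=(G^0,G^1,\mathrm{s},\mathrm{t})$ consists of a nonempty set $G^0$ of vertices, a set $G^1$ of edges, and source and target maps $\mathrm{s},\mathrm{t}:G^1\to G^0$ (no finiteness is assumed). A vertex $v$ is a source if $\mathrm{t}^{-1}(v)=\emptyset$, a sink if $\mathrm{s}^{-1}(v)=\emptyset$, and an infinite receiver if $\mathrm{t}^{-1}(v)$ is infinite. If $w$ is a sink, $G-w$ is the directed graph with vertex set $G^0\setminus\{w\}$, edge set $G^1\setminus \mathrm{t}^{-1}(w)$, and source and target maps restricted from those of $G$. A category has nonempty coproducts if every family of objects indexed by a nonempty set has a coproduct; it has binary coproducts if every pair of objects has a coproduct (equivalently, every family indexed by a finite nonempty set has a coproduct). For a category $\mathsf{C}$, a diagram $D$ in $\mathsf{C}$ of shape $G$ consists of an object $D_v$ of $\mathsf{C}$ for each $v\in G^0$ and a morphism $D_e:D_{\mathrm{s}(e)}\to D_{\mathrm{t}(e)}$ for each $e\in G^1$. A morphism $T:D\to E$ consists of morphisms $T_v:D_v\to E_v$ ($v\in G^0$) with $T_{\mathrm{t}(e)}\circ D_e=E_e\circ T_{\mathrm{s}(e)}$ for all $e\in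 G^1$. The diagram $D$ satisfies the coproduct condition if for every vertex $v$ that is not a source, the family of morphisms $(D_e:D_{\mathrm{s}(e)}\to D_v\mid e\in \mathrm{t}^{-1}(v))$ makes $D_v$ a coproduct in $\mathsf{C}$ of the family $(D_{\mathrm{s}(e)}\mid e\in \mathrm{t}^{-1}(v))$. $\mathsf{Diag}^{\sqcup}_{\mathsf{C}}(G)$ is the category of diagrams in $\mathsf{C}$ of shape $G$ satisfying the coproduct condition, with all morphisms of diagrams between them. *)

theory Defs
  imports "HOL-Library.FuncSet" "Graph_Theory.Digraph"
begin

section \<open>Directed graphs\<close>

text \<open>Multigraphs are those of \<^locale>\<open>wf_digraph\<close>: \<^const>\<open>tail\<close> is the source
  map, \<^const>\<open>head\<close> the target map, and loops, parallel arcs and infinite sets of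
  vertices or arcs are allowed.\<close>

definition directed_graph :: "('v, 'e) pre_digraph \<Rightarrow> bool" where
  "directed_graph G \<longleftrightarrow> wf_digraph G \<and> verts G \<noteq> {}"

definition is_source :: "('v, 'e) pre_digraph \<Rightarrow> 'v \<Rightarrow> bool" where
  "is_source G v \<longleftrightarrow> in_arcs G v = {}"

definition is_sink :: "('v, 'e) pre_digraph \<Rightarrow> 'v \<Rightarrow> bool" where
  "is_sink G v \<longleftrightarrow> out_arcs G v = {}"

definition infinite_receiver :: "('v, 'e) pre_digraph \<Rightarrow> 'v \<Rightarrow> bool" where
  "infinite_receiver G v \<longleftrightarrow> infinite (in_arcs G v)"

text \<open>Only meaningful when \<open>w\<close> is a sink, since arcs leaving \<open>w\<close> are not removed.\<close>

definition remove_sink :: "('v, 'e) pre_digraph \<Rightarrow> 'v \<Rightarrow> ('v, 'e) pre_digraph" where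
  "remove_sink G w =
     \<lparr> verts = verts G - {w}, arcs = arcs G - in_arcs G w, tail = tail G, head = head G \<rparr>"

section \<open>Categories\<close>

record ('o, 'm) cat =
  Obj :: "'o set"
  Arr :: "'m set"
  Dom :: "'m \<Rightarrow> 'o"
  Cod :: "'m \<Rightarrow> 'o"
  Ident :: "'o \<Rightarrow> 'm"
  Comp :: "'m \<Rightarrow> 'm \<Rightarrow> 'm"  \<comment> \<open>\<open>Comp C g f\<close> is \<open>g \<circ> f\<close>\<close>

definition Hom :: "('o, 'm) cat \<Rightarrow> 'o \<Rightarrow> 'o \<Rightarrow> 'm set" where
  "Hom C a b = {f \<in> Arr C. Dom C f = a \<and> Cod C f = b}"

locale category =
  fixes C :: "('o, 'm) cat"
  assumes Dom_in_Obj: "f \<in> Arr C \<Longrightarrow> Dom C f \<in> Obj C"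
    and Cod_in_Obj: "f \<in> Arr C \<Longrightarrow> Cod C f \<in> Obj C"
    and Ident_in_Hom: "a \<in> Obj C \<Longrightarrow> Ident C a \<in> Hom C a a"
    and Comp_in_Hom: "f \<in> Hom C a b \<Longrightarrow> g \<in> Hom C b c \<Longrightarrow> Comp C g f \<in> Hom C a c"
    and Comp_Ident_right: "f \<in> Hom C a b \<Longrightarrow> Comp C f (Ident C a) = f"
    and Comp_Ident_left: "f \<in> Hom C a b \<Longrightarrow> Comp C (Ident C b) f = f"
    and Comp_assoc: "f \<in> Hom C a b \<Longrightarrow> g \<in> Hom C b c \<Longrightarrow> h \<in> Hom C c d \<Longrightarrow>
      Comp C h (Comp C g f) = Comp C (Comp C h g) f"

definition is_coproduct ::
  "('o, 'm) cat \<Rightarrow> 'i set \<Rightarrow> ('i \<Rightarrow> 'o) \<Rightarrow> 'o \<Rightarrow> ('i \<Rightarrow> 'm) \<Rightarrow> bool" where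
  "is_coproduct C I X c \<iota> \<longleftrightarrow>
     c \<in> Obj C \<and> (\<forall>i\<in>I. \<iota> i \<in> Hom C (X i) c) \<and>
     (\<forall>d\<in>Obj C. \<forall>f. (\<forall>i\<in>I. f i \<in> Hom C (X i) d) \<longrightarrow>
        (\<exists>!h. h \<in> Hom C c d \<and> (\<forall>i\<in>I. Comp C h (\<iota> i) = f i)))"

text \<open>HOL cannot quantify over all index types inside a formula, so the type \<open>'i\<close> of
  indices is a parameter that plays the role of the universe of small sets. (Coproducts
  over index sets of unbounded size would force \<open>C\<close>, whose arrows form a set, to be a
  preorder.)\<close>

definition has_nonempty_coproducts :: "'i itself \<Rightarrow> ('o, 'm) cat \<Rightarrow> bool" where
  "has_nonempty_coproducts _ C \<longleftrightarrow>
     (\<forall>(I :: 'i set) X. I \<noteq> {} \<longrightarrow> (\<forall>i\<in>I. X i \<in> Obj C) \<longrightarrow> (\<exists>c \<iota>. is_coproduct C I X c \<iota>))"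

text \<open>A pair of objects is a family indexed by \<^typ>\<open>bool\<close>.\<close>

definition has_binary_coproducts :: "('o, 'm) cat \<Rightarrow> bool" where
  "has_binary_coproducts C \<longleftrightarrow>
     (\<forall>a\<in>Obj C. \<forall>b\<in>Obj C.
        \<exists>c \<iota>. is_coproduct C (UNIV :: bool set) (\<lambda>i. if i then a else b) c \<iota>)"

section \<open>Equivalence of categories\<close>

definition is_functor ::
  "('o, 'm) cat \<Rightarrow> ('p, 'n) cat \<Rightarrow> ('o \<Rightarrow> 'p) \<Rightarrow> ('m \<Rightarrow> 'n) \<Rightarrow> bool" where
  "is_functor A B Fo Fa \<longleftrightarrow>
     (\<forall>a\<in>Obj A. Fo a \<in> Obj B) \<and>
     (\<forall>a\<in>Obj A. \<forall>b\<in>Obj A. \<forall>f\<in>Hom A a b. Fa f \<in> Hom B (Fo a) (Fo b)) \<and>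
     (\<forall>a\<in>Obj A. Fa (Ident A a) = Ident B (Fo a)) \<and>
     (\<forall>a\<in>Obj A. \<forall>b\<in>Obj A. \<forall>c\<in>Obj A. \<forall>f\<in>Hom A a b. \<forall>g\<in>Hom A b c.
        Fa (Comp A g f) = Comp B (Fa g) (Fa f))"

definition is_iso :: "('o, 'm) cat \<Rightarrow> 'o \<Rightarrow> 'o \<Rightarrow> 'm \<Rightarrow> bool" where
  "is_iso C a b f \<longleftrightarrow> f \<in> Hom C a b \<and>
     (\<exists>g\<in>Hom C b a. Comp C g f = Ident C a \<and> Comp C f g = Ident C b)"

definition is_natural_iso ::
  "('o, 'm) cat \<Rightarrow> ('p, 'n) cat \<Rightarrow> ('o \<Rightarrow> 'p) \<Rightarrow> ('m \<Rightarrow> 'n) \<Rightarrow> ('o \<Rightarrow> 'p) \<Rightarrow> ('m \<Rightarrow> 'n) \<Rightarrow>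
   ('o \<Rightarrow> 'n) \<Rightarrow> bool" where
  "is_natural_iso A B Fo Fa Go Ga \<tau> \<longleftrightarrow>
     (\<forall>a\<in>Obj A. is_iso B (Fo a) (Go a) (\<tau> a)) \<and>
     (\<forall>a\<in>Obj A. \<forall>b\<in>Obj A. \<forall>f\<in>Hom A a b. Comp B (\<tau> b) (Fa f) = Comp B (Ga f) (\<tau> a))"

definition equivalent_categories :: "('o, 'm) cat \<Rightarrow> ('p, 'n) cat \<Rightarrow> bool" where
  "equivalent_categories A B \<longleftrightarrow> category A \<and> category B \<and>
     (\<exists>Fo Fa Go Ga \<eta> \<epsilon>. is_functor A B Fo Fa \<and> is_functor B A Go Ga \<and>
        is_natural_iso A A id id (Go \<circ> Fo) (Ga \<circ> Fa) \<eta> \<and>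
        is_natural_iso B B (Fo \<circ> Go) (Fa \<circ> Ga) id id \<epsilon>)"

section \<open>Diagrams satisfying the coproduct condition\<close>

record ('v, 'e, 'o, 'm) diagram =
  D_obj :: "'v \<Rightarrow> 'o"
  D_arr :: "'e \<Rightarrow> 'm"

text \<open>Families indexed by \<open>verts G\<close> or \<open>arcs G\<close> are extensional functions, so that
  equal families are equal HOL functions.\<close>

definition is_diagram ::
  "('o, 'm) cat \<Rightarrow> ('v, 'e) pre_digraph \<Rightarrow> ('v, 'e, 'o, 'm) diagram \<Rightarrow> bool" where
  "is_diagram C G D \<longleftrightarrow>
     D_obj D \<in> verts G \<rightarrow>\<^sub>E Obj C \<and>
     D_arr D \<in> (\<Pi>\<^sub>E e\<in>arcs G. Hom C (D_obj D (tail G e)) (D_obj D (head G e)))"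

definition is_diagram_morphism ::
  "('o, 'm) cat \<Rightarrow> ('v, 'e) pre_digraph \<Rightarrow> ('v, 'e, 'o, 'm) diagram \<Rightarrow>
   ('v, 'e, 'o, 'm) diagram \<Rightarrow> ('v \<Rightarrow> 'm) \<Rightarrow> bool" where
  "is_diagram_morphism C G D E T \<longleftrightarrow>
     T \<in> (\<Pi>\<^sub>E v\<in>verts G. Hom C (D_obj D v) (D_obj E v)) \<and>
     (\<forall>e\<in>arcs G. Comp C (T (head G e)) (D_arr D e) = Comp C (D_arr E e) (T (tail G e)))"

definition coproduct_condition ::
  "('o, 'm) cat \<Rightarrow> ('v, 'e) pre_digraph \<Rightarrow> ('v, 'e, 'o, 'm) diagram \<Rightarrow> bool" where
  "coproduct_condition C G D \<longleftrightarrow>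
     (\<forall>v\<in>verts G. \<not> is_source G v \<longrightarrow>
        is_coproduct C (in_arcs G v) (\<lambda>e. D_obj D (tail G e)) (D_obj D v) (D_arr D))"

text \<open>An arrow is a triple \<open>(D, T, E)\<close> because the family \<open>T\<close> alone does not determine
  the diagrams it is a morphism between.\<close>

definition Diag_coprod ::
  "('o, 'm) cat \<Rightarrow> ('v, 'e) pre_digraph \<Rightarrow>
   (('v, 'e, 'o, 'm) diagram,
    ('v, 'e, 'o, 'm) diagram \<times> ('v \<Rightarrow> 'm) \<times> ('v, 'e, 'o, 'm) diagram) cat" where
  "Diag_coprod C G =
     \<lparr> Obj = {D. is_diagram C G D \<and> coproduct_condition C G D},
       Arr = {(D, T, E). is_diagram C G D \<and> coproduct_condition C G D \<and>
                is_diagram C G E \<and> coproduct_condition C G E \<and> is_diagram_morphism C G D E T},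
       Dom = (\<lambda>(D, T, E). D),
       Cod = (\<lambda>(D, T, E). E),
       Ident = (\<lambda>D. (D, \<lambda>v\<in>verts G. Ident C (D_obj D v), D)),
       Comp = (\<lambda>(E', U, F) (D, T, E). (D, \<lambda>v\<in>verts G. Comp C (U v) (T v), F)) \<rparr>"

lemma Hom_Diag_coprod:
  "f \<in> Hom (Diag_coprod C G) D E \<longleftrightarrow>
     (\<exists>T. f = (D, T, E) \<and> is_diagram C G D \<and> coproduct_condition C G D \<and>
        is_diagram C G E \<and> coproduct_condition C G E \<and> is_diagram_morphism C G D E T)"
  by (auto simp: Hom_def Diag_coprod_def)

lemma is_diagram_morphism_Ident:
  assumes "category C" "wf_digraph G" "is_diagram C G D"
  shows "is_diagram_morphism C G D D (\<lambda>v\<in>verts G. Ident C (D_obj D v))"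
proof -
  interpret category C by fact
  interpret wf_digraph G by fact
  have o: "D_obj D v \<in> Obj C" if "v \<in> verts G" for v
    using assms(3) that by (auto simp: is_diagram_def)
  have a: "D_arr D e \<in> Hom C (D_obj D (tail G e)) (D_obj D (head G e))" if "e \<in> arcs G" for e
    using assms(3) that by (auto simp: is_diagram_def)
  show ?thesis
    using o a by (auto simp: is_diagram_morphism_def Ident_in_Hom
        Comp_Ident_left[OF a] Comp_Ident_right[OF a])
qed

lemma is_diagram_morphism_Comp:
  assumes "category C" "wf_digraph G" "is_diagram C G D" "is_diagram C G E" "is_diagram C G F"
    and T: "is_diagram_morphism C G D E T" and U: "is_diagram_morphism C G E F U"
  shows "is_diagram_morphism C G D F (\<lambda>v\<in>verts G. Comp C (U v) (T v))"
proof -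
  interpret category C by fact
  interpret wf_digraph G by fact
  have arr: "D_arr X e \<in> Hom C (D_obj X (tail G e)) (D_obj X (head G e))"
    if "e \<in> arcs G" "is_diagram C G X" for X e
    using that by (auto simp: is_diagram_def)
  have t: "T v \<in> Hom C (D_obj D v) (D_obj E v)" and u: "U v \<in> Hom C (D_obj E v) (D_obj F v)"
    if "v \<in> verts G" for v
    using T U that by (auto simp: is_diagram_morphism_def)
  have "Comp C (Comp C (U (head G e)) (T (head G e))) (D_arr D e) =
        Comp C (D_arr F e) (Comp C (U (tail G e)) (T (tail G e)))" if e: "e \<in> arcs G" for e
  proof -
    have h: "head G e \<in> verts G" and tl: "tail G e \<in> verts G" using e by auto
    have "Comp C (Comp C (U (head G e)) (T (head G e))) (D_arr D e) =
          Comp C (U (head G e)) (Comp C (T (head G e)) (D_arr D e))"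
      using Comp_assoc[OF arr[OF e assms(3)] t[OF h] u[OF h]] by simp
    also have "\<dots> = Comp C (U (head G e)) (Comp C (D_arr E e) (T (tail G e)))"
      using T e by (simp add: is_diagram_morphism_def)
    also have "\<dots> = Comp C (Comp C (U (head G e)) (D_arr E e)) (T (tail G e))"
      using Comp_assoc[OF t[OF tl] arr[OF e assms(4)] u[OF h]] by simp
    also have "\<dots> = Comp C (Comp C (D_arr F e) (U (tail G e))) (T (tail G e))"
      using U e by (simp add: is_diagram_morphism_def)
    also have "\<dots> = Comp C (D_arr F e) (Comp C (U (tail G e)) (T (tail G e)))"
      using Comp_assoc[OF t[OF tl] u[OF tl] arr[OF e assms(5)]] by simp
    finally show ?thesis .
  qed
  then show ?thesis
    using Comp_in_Hom[OF t u] by (auto simp: is_diagram_morphism_def)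
qed

lemma category_Diag_coprod:
  assumes "category C" "wf_digraph G"
  shows "category (Diag_coprod C G)"
proof -
  interpret category C by fact
  have ext: "(\<lambda>v\<in>verts G. S v) = T"
    if "is_diagram_morphism C G D E T"
      "\<And>v. v \<in> verts G \<Longrightarrow> T v \<in> Hom C (D_obj D v) (D_obj E v) \<Longrightarrow> S v = T v" for D E S T
    using that by (fastforce simp: is_diagram_morphism_def PiE_iff extensional_def)
  have mem: "T v \<in> Hom C (D_obj D v) (D_obj E v)"
    if "is_diagram_morphism C G D E T" "v \<in> verts G" for D E T v
    using that by (auto simp: is_diagram_morphism_def)
  let ?D = "Diag_coprod C G"
  show ?thesis
  proof
    fix f assume "f \<in> Arr ?D"
    then show "Dom ?D f \<in> Obj ?D" "Cod ?D f \<in> Obj ?D" by (auto simp: Diag_coprod_def)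
  next
    fix a assume "a \<in> Obj ?D"
    then show "Ident ?D a \<in> Hom ?D a a"
      using is_diagram_morphism_Ident[OF assms] by (auto simp: Hom_Diag_coprod)
        (auto simp: Diag_coprod_def)
  next
    fix f g a b c assume "f \<in> Hom ?D a b" "g \<in> Hom ?D b c"
    then show "Comp ?D g f \<in> Hom ?D a c"
      using is_diagram_morphism_Comp[OF assms]
      by (auto simp: Hom_Diag_coprod) (auto simp: Diag_coprod_def)
  next
    fix f a b assume "f \<in> Hom ?D a b"
    then obtain T where f: "f = (a, T, b)" and T: "is_diagram_morphism C G a b T"
      by (auto simp: Hom_Diag_coprod)
    show "Comp ?D f (Ident ?D a) = f"
      using ext[OF T] by (simp add: f Diag_coprod_def Comp_Ident_right cong: restrict_cong)
    show "Comp ?D (Ident ?D b) f = f"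
      using ext[OF T] by (simp add: f Diag_coprod_def Comp_Ident_left cong: restrict_cong)
  next
    fix f g h a b c d assume "f \<in> Hom ?D a b" "g \<in> Hom ?D b c" "h \<in> Hom ?D c d"
    then obtain T U V where f: "f = (a, T, b)" "g = (b, U, c)" "h = (c, V, d)"
      and T: "is_diagram_morphism C G a b T" "is_diagram_morphism C G b c U"
        "is_diagram_morphism C G c d V"
      by (auto simp: Hom_Diag_coprod)
    have "Comp C (V v) (Comp C (U v) (T v)) = Comp C (Comp C (V v) (U v)) (T v)"
      if "v \<in> verts G" for v
      by (rule Comp_assoc[OF mem[OF T(1) that] mem[OF T(2) that] mem[OF T(3) that]])
    then show "Comp ?D h (Comp ?D g f) = Comp ?D (Comp ?D h g) f"
      by (simp add: f Diag_coprod_def cong: restrict_cong)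
  qed
qed

end

theory Submission
  imports Defs
begin

text \<open>Forgetting the vertex \<open>w\<close> and the arcs that end there is a functor from
  \<open>Diag_coprod C G\<close> to \<open>Diag_coprod C (remove_sink G w)\<close>: since \<open>w\<close> is a sink, no arc of the
  smaller graph starts at \<open>w\<close>, and every other vertex keeps all its incoming arcs, hence its
  coproduct condition.

  This functor is fully faithful. At \<open>w\<close>, which is not a source, a diagram \<open>D\<close> carries a coproduct
  of the objects at the tails of the incoming arcs, and these tails survive in the smaller graph.
  The component at \<open>w\<close> of a morphism \<open>D \<rightarrow> E\<close> must therefore be the arrow induced by the components
  at these tails, and this arrow does complete every morphism of restricted diagrams (lemmas
  \<open>restrict_arrow_inj\<close> and \<open>restrict_arrow_surj\<close>).

  It is surjective on objects as soon as \<open>C\<close> has a coproduct for every family indexed by the arcs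
  into \<open>w\<close>: put such a coproduct at \<open>w\<close> (lemma \<open>extension_to_sink\<close>). This index set is nonempty, and
  if it is finite then binary coproducts are enough (lemma \<open>finite_coproducts\<close>). A fully faithful
  functor that is surjective on objects is an equivalence (lemma \<open>equivalence_criterion\<close>).\<close>

section \<open>Fully faithful functors that are surjective on objects\<close>

lemma HomD:
  assumes "category C" "f \<in> Hom C a b"
  shows "a \<in> Obj C" "b \<in> Obj C" "Dom C f = a" "Cod C f = b"
  using category.Dom_in_Obj[OF assms(1)] category.Cod_in_Obj[OF assms(1)] assms(2)
  by (auto simp: Hom_def)

text \<open>Choose a preimage \<open>Go b\<close> of every object \<open>b\<close>, and let \<open>Ga\<close> take an arrow to its only lift
  between the chosen preimages. Then \<open>Fo (Go b) = b\<close> holds on the nose, so the counit is the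
  identity, and the unit at \<open>a\<close> is the lift of the identity of \<open>Fo a\<close> to an arrow
  \<open>a \<rightarrow> Go (Fo a)\<close>. The laws in \<open>A\<close> hold because they
  hold after applying the faithful functor.\<close>

lemma equivalence_criterion:
  assumes A: "category A" and B: "category B" and F: "is_functor A B Fo Fa"
    and inj: "\<And>a b. a \<in> Obj A \<Longrightarrow> b \<in> Obj A \<Longrightarrow> inj_on Fa (Hom A a b)"
    and full: "\<And>a b g. a \<in> Obj A \<Longrightarrow> b \<in> Obj A \<Longrightarrow> g \<in> Hom B (Fo a) (Fo b) \<Longrightarrow> g \<in> Fa ` Hom A a b"
    and surj: "\<And>b. b \<in> Obj B \<Longrightarrow> b \<in> Fo ` Obj A"
  shows "equivalent_categories A B"
proof -
  interpret A: category A by fact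
  interpret B: category B by fact
  have Fo: "Fo a \<in> Obj B" if "a \<in> Obj A" for a
    using F that by (auto simp: is_functor_def)
  have Fa: "Fa f \<in> Hom B (Fo a) (Fo b)" if "f \<in> Hom A a b" for f a b
    using F that HomD[OF A that] by (auto simp: is_functor_def)
  have F_Ident: "Fa (Ident A a) = Ident B (Fo a)" if "a \<in> Obj A" for a
    using F that by (auto simp: is_functor_def)
  have F_Comp: "Fa (Comp A g f) = Comp B (Fa g) (Fa f)"
    if "f \<in> Hom A a b" "g \<in> Hom A b c" for f g a b c
    using F that HomD[OF A that(1)] HomD[OF A that(2)] by (auto simp: is_functor_def)
  have eqI: "f = g" if "f \<in> Hom A a b" "g \<in> Hom A a b" "Fa f = Fa g" for f g a b
    using inj_onD[OF inj that(3) that(1,2)] HomD[OF A that(1)] by blast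
  define Go where "Go b = (SOME a. a \<in> Obj A \<and> Fo a = b)" for b
  have Go: "Go b \<in> Obj A" "Fo (Go b) = b" if "b \<in> Obj B" for b
  proof -
    have "\<exists>a. a \<in> Obj A \<and> Fo a = b" using surj[OF that] by blast
    from someI_ex[OF this] show "Go b \<in> Obj A" "Fo (Go b) = b" by (simp_all add: Go_def)
  qed
  define lift where "lift a b g = (SOME f. f \<in> Hom A a b \<and> Fa f = g)" for a b g
  have lift: "lift a b g \<in> Hom A a b" "Fa (lift a b g) = g"
    if "a \<in> Obj A" "b \<in> Obj A" "g \<in> Hom B (Fo a) (Fo b)" for a b g
  proof -
    have "\<exists>f. f \<in> Hom A a b \<and> Fa f = g" using full[OF that] by blast
    from someI_ex[OF this] show "lift a b g \<in> Hom A a b" "Fa (lift a b g) = g"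
      by (simp_all add: lift_def)
  qed
  define Ga where "Ga g = lift (Go (Dom B g)) (Go (Cod B g)) g" for g
  have Ga: "Ga g \<in> Hom A (Go a) (Go b)" "Fa (Ga g) = g" if "g \<in> Hom B a b" for g a b
    using lift[of "Go a" "Go b" g] Go[OF HomD(1)[OF B that]] Go[OF HomD(2)[OF B that]]
      that HomD(3,4)[OF B that]
    by (simp_all add: Ga_def)
  define \<eta> where "\<eta> a = lift a (Go (Fo a)) (Ident B (Fo a))" for a
  define \<theta> where "\<theta> a = lift (Go (Fo a)) a (Ident B (Fo a))" for a
  have unit: "\<eta> a \<in> Hom A a (Go (Fo a))" "Fa (\<eta> a) = Ident B (Fo a)"
    "\<theta> a \<in> Hom A (Go (Fo a)) a" "Fa (\<theta> a) = Ident B (Fo a)"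
    if "a \<in> Obj A" for a
    using lift[of a "Go (Fo a)" "Ident B (Fo a)"] lift[of "Go (Fo a)" a "Ident B (Fo a)"]
      that Go[OF Fo[OF that]] B.Ident_in_Hom[OF Fo[OF that]]
    by (simp_all add: \<eta>_def \<theta>_def)
  have G: "is_functor B A Go Ga"
    unfolding is_functor_def
  proof (intro conjI ballI)
    fix b assume b: "b \<in> Obj B"
    show "Go b \<in> Obj A" using Go[OF b] by simp
    show "Ga (Ident B b) = Ident A (Go b)"
      by (rule eqI[OF Ga(1)[OF B.Ident_in_Hom[OF b]] A.Ident_in_Hom[OF Go(1)[OF b]]])
        (simp add: Ga(2)[OF B.Ident_in_Hom[OF b]] F_Ident Go b)
  next
    fix a b g assume "g \<in> Hom B a b"
    then show "Ga g \<in> Hom A (Go a) (Go b)" by (rule Ga)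
  next
    fix a b c f g assume fg: "f \<in> Hom B a b" "g \<in> Hom B b c"
    show "Ga (Comp B g f) = Comp A (Ga g) (Ga f)"
      by (rule eqI[OF Ga(1)[OF B.Comp_in_Hom[OF fg]]
            A.Comp_in_Hom[OF Ga(1)[OF fg(1)] Ga(1)[OF fg(2)]]])
        (simp add: Ga(2)[OF B.Comp_in_Hom[OF fg]] F_Comp[OF Ga(1)[OF fg(1)] Ga(1)[OF fg(2)]]
          Ga(2)[OF fg(1)] Ga(2)[OF fg(2)])
  qed
  have \<eta>_iso: "is_iso A a (Go (Fo a)) (\<eta> a)" if a: "a \<in> Obj A" for a
  proof -
    note u = unit[OF a] and ga = Go[OF Fo[OF a]]
    note idid = B.Comp_Ident_left[OF B.Ident_in_Hom[OF Fo[OF a]]]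
    have "Comp A (\<theta> a) (\<eta> a) = Ident A a"
      by (rule eqI[OF A.Comp_in_Hom[OF u(1,3)] A.Ident_in_Hom[OF a]])
        (simp add: F_Comp[OF u(1,3)] u F_Ident a idid)
    moreover have "Comp A (\<eta> a) (\<theta> a) = Ident A (Go (Fo a))"
      by (rule eqI[OF A.Comp_in_Hom[OF u(3,1)] A.Ident_in_Hom[OF ga(1)]])
        (simp add: F_Comp[OF u(3,1)] u F_Ident ga idid)
    ultimately show ?thesis using u by (auto simp: is_iso_def)
  qed
  have \<eta>_nat: "Comp A (\<eta> b) f = Comp A (Ga (Fa f)) (\<eta> a)" if f: "f \<in> Hom A a b" for a b f
  proof -
    note u = unit[OF HomD(1)[OF A f]] and v = unit[OF HomD(2)[OF A f]]
    note Ff = Fa[OF f]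
    show ?thesis
      by (rule eqI[OF A.Comp_in_Hom[OF f v(1)] A.Comp_in_Hom[OF u(1) Ga(1)[OF Ff]]])
        (simp add: F_Comp[OF f v(1)] F_Comp[OF u(1) Ga(1)[OF Ff]] u v Ga(2)[OF Ff]
          B.Comp_Ident_left[OF Ff] B.Comp_Ident_right[OF Ff])
  qed
  have "is_natural_iso A A id id (Go \<circ> Fo) (Ga \<circ> Fa) \<eta>"
    using \<eta>_iso \<eta>_nat by (simp add: is_natural_iso_def)
  moreover have "is_natural_iso B B (Fo \<circ> Go) (Fa \<circ> Ga) id id (Ident B)"
    unfolding is_natural_iso_def
  proof (intro conjI ballI)
    fix b assume b: "b \<in> Obj B"
    show "is_iso B ((Fo \<circ> Go) b) (id b) (Ident B b)"
      using B.Ident_in_Hom[OF b] B.Comp_Ident_left[OF B.Ident_in_Hom[OF b]]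
      by (auto simp: is_iso_def Go b)
  next
    fix a b g assume g: "g \<in> Hom B a b"
    show "Comp B (Ident B b) ((Fa \<circ> Ga) g) = Comp B (id g) (Ident B a)"
      by (simp add: Ga(2)[OF g] B.Comp_Ident_left[OF g] B.Comp_Ident_right[OF g])
  qed
  ultimately show ?thesis
    using A B F G unfolding equivalent_categories_def by blast
qed

section \<open>Coproducts of finite families\<close>

lemma is_coproductD:
  assumes "is_coproduct C I X c \<iota>"
  shows "c \<in> Obj C" "\<And>i. i \<in> I \<Longrightarrow> \<iota> i \<in> Hom C (X i) c"
  using assms by (simp_all add: is_coproduct_def)

lemma coproduct_mediating_exists:
  assumes "is_coproduct C I X c \<iota>" "d \<in> Obj C" "\<And>i. i \<in> I \<Longrightarrow> f i \<in> Hom C (X i) d"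
  obtains h where "h \<in> Hom C c d" "\<And>i. i \<in> I \<Longrightarrow> Comp C h (\<iota> i) = f i"
proof -
  have "\<exists>!h. h \<in> Hom C c d \<and> (\<forall>i\<in>I. Comp C h (\<iota> i) = f i)"
    using assms by (simp add: is_coproduct_def)
  then obtain h where "h \<in> Hom C c d" "\<forall>i\<in>I. Comp C h (\<iota> i) = f i" by (elim ex1E conjE)
  then show thesis by (intro that[of h]) simp_all
qed

lemma coproduct_mediating_unique:
  assumes "category C" "is_coproduct C I X c \<iota>" "h \<in> Hom C c d" "k \<in> Hom C c d"
    and "\<And>i. i \<in> I \<Longrightarrow> Comp C h (\<iota> i) = Comp C k (\<iota> i)"
  shows "h = k"
proof -
  have d: "d \<in> Obj C" using HomD[OF assms(1,3)] by simp
  have "\<forall>i\<in>I. Comp C k (\<iota> i) \<in> Hom C (X i) d"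
    using category.Comp_in_Hom[OF assms(1)] is_coproductD[OF assms(2)] assms(4) by blast
  then have "\<exists>!h. h \<in> Hom C c d \<and> (\<forall>i\<in>I. Comp C h (\<iota> i) = Comp C k (\<iota> i))"
    using assms(2) d by (simp add: is_coproduct_def)
  then obtain m where m: "\<forall>h. h \<in> Hom C c d \<and> (\<forall>i\<in>I. Comp C h (\<iota> i) = Comp C k (\<iota> i)) \<longrightarrow> h = m"
    by (elim ex1E)
  have "h = m" using m[rule_format, of h] assms(3,5) by simp
  moreover have "k = m" using m[rule_format, of k] assms(4) by simp
  ultimately show ?thesis by simp
qed

lemma is_coproduct_cong:
  assumes "I = J" "\<And>i. i \<in> J \<Longrightarrow> X i = Y i" "c = d" "\<And>i. i \<in> J \<Longrightarrow> \<iota> i = \<kappa> i"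
  shows "is_coproduct C I X c \<iota> \<longleftrightarrow> is_coproduct C J Y d \<kappa>"
  using assms by (simp add: is_coproduct_def)

lemma is_coproduct_singleton:
  assumes "category C" "X i \<in> Obj C"
  shows "is_coproduct C {i} X (X i) (\<lambda>_. Ident C (X i))"
proof -
  interpret category C by fact
  have "\<exists>!h. h \<in> Hom C (X i) d \<and> Comp C h (Ident C (X i)) = f" if "f \<in> Hom C (X i) d" for d f
    using that Comp_Ident_right by (intro ex1I[of _ f]) auto
  then show ?thesis
    using assms(2) by (simp add: is_coproduct_def Ident_in_Hom)
qed

text \<open>Associativity, \<open>X j \<squnion> (\<Squnion>\<^sub>I X)\<close> being a coproduct over \<open>insert j I\<close>. A family of arrows out of
  the \<open>X i\<close> induces first an arrow out of the summand over \<open>I\<close> and then, paired with its member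
  at \<open>j\<close>, an arrow out of \<open>p\<close>; uniqueness is obtained by the same two stages.\<close>

lemma is_coproduct_insert:
  assumes C: "category C" and "j \<notin> I" and c: "is_coproduct C I X c \<iota>"
    and p: "is_coproduct C (UNIV :: bool set) (\<lambda>i. if i then X j else c) p \<kappa>"
  shows "is_coproduct C (insert j I) X p
           (\<lambda>i. if i = j then \<kappa> True else Comp C (\<kappa> False) (\<iota> i))"
proof -
  interpret category C by fact
  let ?\<mu> = "\<lambda>i. if i = j then \<kappa> True else Comp C (\<kappa> False) (\<iota> i)"
  have \<kappa>: "\<kappa> True \<in> Hom C (X j) p" "\<kappa> False \<in> Hom C c p"
    using is_coproductD(2)[OF p, of True] is_coproductD(2)[OF p, of False] by simp_all
  have \<mu>: "?\<mu> i \<in> Hom C (X i) p" if "i \<in> insert j I" for i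
    using that \<kappa> Comp_in_Hom[OF is_coproductD(2)[OF c] \<kappa>(2)] by auto
  have \<mu>_I: "Comp C h (?\<mu> i) = Comp C (Comp C h (\<kappa> False)) (\<iota> i)"
    if "i \<in> I" "h \<in> Hom C p d" for i h d
    using that \<open>j \<notin> I\<close> Comp_assoc[OF is_coproductD(2)[OF c that(1)] \<kappa>(2) that(2)] by auto
  have "\<exists>!h. h \<in> Hom C p d \<and> (\<forall>i\<in>insert j I. Comp C h (?\<mu> i) = f i)"
    if d: "d \<in> Obj C" and f: "\<forall>i\<in>insert j I. f i \<in> Hom C (X i) d" for d f
  proof -
    obtain k where k: "k \<in> Hom C c d" "\<And>i. i \<in> I \<Longrightarrow> Comp C k (\<iota> i) = f i"
      by (rule coproduct_mediating_exists[OF c d, of f]) (use f in auto)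
    obtain h where h: "h \<in> Hom C p d"
      "\<And>i. Comp C h (\<kappa> i) = (if i then f j else k)"
    proof (rule coproduct_mediating_exists[OF p d, of "\<lambda>i. if i then f j else k"])
      show "(if i then f j else k) \<in> Hom C (if i then X j else c) d" for i
        using f k(1) by simp
    qed simp
    have h_\<mu>: "Comp C h (?\<mu> i) = f i" if "i \<in> insert j I" for i
    proof (cases "i = j")
      case False
      then have "i \<in> I" using that by simp
      from \<mu>_I[OF this h(1)] show ?thesis using h(2)[of False] k(2)[OF \<open>i \<in> I\<close>] by simp
    qed (simp add: h)
    have unique: "h' = h"
      if h': "h' \<in> Hom C p d" "\<forall>i\<in>insert j I. Comp C h' (?\<mu> i) = f i" for h'
    proof (rule coproduct_mediating_unique[OF C p h'(1) h(1)])
      fix i :: bool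
      have "Comp C h' (\<kappa> False) = k"
      proof (rule coproduct_mediating_unique[OF C c Comp_in_Hom[OF \<kappa>(2) h'(1)] k(1)])
        fix i assume "i \<in> I"
        then show "Comp C (Comp C h' (\<kappa> False)) (\<iota> i) = Comp C k (\<iota> i)"
          using \<mu>_I[OF \<open>i \<in> I\<close> h'(1)] h'(2) k(2) by simp
      qed
      moreover have "Comp C h' (\<kappa> True) = f j" using h'(2) by simp
      ultimately show "Comp C h' (\<kappa> i) = Comp C h (\<kappa> i)"
        by (cases i) (simp_all add: h(2))
    qed
    show ?thesis
    proof (rule ex1I[of _ h], intro conjI ballI)
      show "h \<in> Hom C p d" by fact
      show "Comp C h (?\<mu> i) = f i" if "i \<in> insert j I" for i using that by (rule h_\<mu>)
      show "h' = h" if "h' \<in> Hom C p d \<and> (\<forall>i\<in>insert j I. Comp C h' (?\<mu> i) = f i)" for h'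
        using that by (elim conjE) (rule unique)
    qed
  qed
  with \<mu> show ?thesis
    unfolding is_coproduct_def by (intro conjI ballI allI impI is_coproductD(1)[OF p])
qed

lemma finite_coproducts:
  assumes C: "category C" and bin: "has_binary_coproducts C"
    and "finite I" "I \<noteq> {}" "\<And>i. i \<in> I \<Longrightarrow> X i \<in> Obj C"
  shows "\<exists>c \<iota>. is_coproduct C I X c \<iota>"
  using assms(3-5)
proof (induction I rule: finite_ne_induct)
  case (singleton i)
  then have "is_coproduct C {i} X (X i) (\<lambda>_. Ident C (X i))"
    by (intro is_coproduct_singleton[OF C]) simp
  then show ?case by (intro exI)
next
  case (insert j I)
  have "\<exists>c \<iota>. is_coproduct C I X c \<iota>"
    by (rule insert.IH) (simp add: insert.prems)
  then obtain c \<iota> where c: "is_coproduct C I X c \<iota>" by (elim exE)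
  obtain p \<kappa> where "is_coproduct C (UNIV :: bool set) (\<lambda>i. if i then X j else c) p \<kappa>"
    using bin[unfolded has_binary_coproducts_def, rule_format, of "X j" c]
      is_coproductD(1)[OF c] insert.prems[of j] by auto
  from is_coproduct_insert[OF C \<open>j \<notin> I\<close> c this] show ?case by (intro exI)
qed

section \<open>Forgetting a sink\<close>

definition restrict_diagram ::
  "('v, 'e) pre_digraph \<Rightarrow> ('v, 'e, 'o, 'm) diagram \<Rightarrow> ('v, 'e, 'o, 'm) diagram" where
  "restrict_diagram H D =
     \<lparr> D_obj = restrict (D_obj D) (verts H), D_arr = restrict (D_arr D) (arcs H) \<rparr>"

fun restrict_arrow ::
  "('v, 'e) pre_digraph \<Rightarrow>
   ('v, 'e, 'o, 'm) diagram \<times> ('v \<Rightarrow> 'm) \<times> ('v, 'e, 'o, 'm) diagram \<Rightarrow>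
   ('v, 'e, 'o, 'm) diagram \<times> ('v \<Rightarrow> 'm) \<times> ('v, 'e, 'o, 'm) diagram" where
  "restrict_arrow H (D, T, E) =
     (restrict_diagram H D, restrict T (verts H), restrict_diagram H E)"

locale nonsource_sink = wf_digraph G + category C
  for G :: "('v, 'e) pre_digraph" and w :: 'v and C :: "('o, 'm) cat" +
  assumes w: "w \<in> verts G" and sink: "is_sink G w" and nonsource: "\<not> is_source G w"
begin

abbreviation H where "H \<equiv> remove_sink G w"

lemma tail_noteq_sink: "e \<in> arcs G \<Longrightarrow> tail G e \<noteq> w"
  using sink by (auto simp: is_sink_def out_arcs_def)

lemma H_simps [simp]:
  "verts H = verts G - {w}" "arcs H = {e \<in> arcs G. head G e \<noteq> w}" "tail H = tail G" "head H = head G"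
  by (auto simp: remove_sink_def)

lemma wf_H: "wf_digraph H"
  by unfold_locales (auto simp: tail_noteq_sink)

lemma in_arcs_H: "v \<noteq> w \<Longrightarrow> in_arcs H v = in_arcs G v"
  by (auto simp: in_arcs_def)

lemma is_diagram_restrict:
  assumes "is_diagram C G D"
  shows "is_diagram C H (restrict_diagram H D)"
  using assms unfolding is_diagram_def restrict_diagram_def
  by (auto simp: PiE_iff tail_noteq_sink)

text \<open>Apart from \<open>w\<close>, the two graphs have the same incoming arcs at each vertex, so the only
  condition lost by restriction is the one at \<open>w\<close>.\<close>

lemma coproduct_condition_restrict_iff:
  "coproduct_condition C G D \<longleftrightarrow>
     coproduct_condition C H (restrict_diagram H D) \<and>
     is_coproduct C (in_arcs G w) (\<lambda>e. D_obj D (tail G e)) (D_obj D w) (D_arr D)"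
proof -
  have "is_coproduct C (in_arcs H v) (\<lambda>e. D_obj (restrict_diagram H D) (tail H e))
          (D_obj (restrict_diagram H D) v) (D_arr (restrict_diagram H D)) \<longleftrightarrow>
        is_coproduct C (in_arcs G v) (\<lambda>e. D_obj D (tail G e)) (D_obj D v) (D_arr D)"
    if "v \<in> verts H" for v
    using that
    by (intro is_coproduct_cong) (auto simp: in_arcs_H restrict_diagram_def tail_noteq_sink)
  moreover have "is_source H v \<longleftrightarrow> is_source G v" if "v \<in> verts H" for v
    using that by (simp add: is_source_def in_arcs_H)
  ultimately show ?thesis
    using w nonsource unfolding coproduct_condition_def
    by (auto simp del: H_simps(2-4))
qed

lemma is_diagram_morphism_restrict:
  assumes "is_diagram_morphism C G D E T"
  shows "is_diagram_morphism C H (restrict_diagram H D) (restrict_diagram H E)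
           (restrict T (verts H))"
  using assms unfolding is_diagram_morphism_def restrict_diagram_def
  by (auto simp: PiE_iff tail_noteq_sink)

lemma is_functor_restrict:
  "is_functor (Diag_coprod C G) (Diag_coprod C H) (restrict_diagram H) (restrict_arrow H)"
  unfolding is_functor_def
proof (intro conjI ballI)
  fix D assume D: "D \<in> Obj (Diag_coprod C G)"
  then show "restrict_diagram H D \<in> Obj (Diag_coprod C H)"
    using is_diagram_restrict coproduct_condition_restrict_iff by (auto simp: Diag_coprod_def)
  show "restrict_arrow H (Ident (Diag_coprod C G) D) =
        Ident (Diag_coprod C H) (restrict_diagram H D)"
    by (auto simp: Diag_coprod_def restrict_diagram_def restrict_def fun_eq_iff)
next
  fix D E f assume "f \<in> Hom (Diag_coprod C G) D E"
  then show "restrict_arrow H f \<in> Hom (Diag_coprod C H) (restrict_diagram H D) (restrict_diagram H E)"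
    using is_diagram_restrict coproduct_condition_restrict_iff is_diagram_morphism_restrict
    by (auto simp: Hom_Diag_coprod simp del: H_simps)
next
  fix D E F f g
  assume "f \<in> Hom (Diag_coprod C G) D E" "g \<in> Hom (Diag_coprod C G) E F"
  then show "restrict_arrow H (Comp (Diag_coprod C G) g f) =
        Comp (Diag_coprod C H) (restrict_arrow H g) (restrict_arrow H f)"
    unfolding Hom_Diag_coprod
    by (auto simp: Diag_coprod_def restrict_def fun_eq_iff)
qed

text \<open>The value at \<open>w\<close> of a morphism is determined on the coproduct injections, where
  commutation expresses it through values at vertices other than \<open>w\<close>.\<close>

lemma restrict_arrow_inj: "inj_on (restrict_arrow H) (Hom (Diag_coprod C G) D E)"
proof (rule inj_onI)
  fix f g assume "f \<in> Hom (Diag_coprod C G) D E" "g \<in> Hom (Diag_coprod C G) D E"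
    and eq: "restrict_arrow H f = restrict_arrow H g"
  then obtain T U where f: "f = (D, T, E)" and g: "g = (D, U, E)"
    and D: "coproduct_condition C G D"
    and T: "is_diagram_morphism C G D E T" and U: "is_diagram_morphism C G D E U"
    by (auto simp: Hom_Diag_coprod)
  have restrict_eq: "restrict T (verts H) = restrict U (verts H)"
    using eq by (simp add: f g)
  have off_w: "T v = U v" if "v \<in> verts G" "v \<noteq> w" for v
    using fun_cong[OF restrict_eq, of v] that by simp
  have "T w = U w"
  proof (rule coproduct_mediating_unique)
    show "is_coproduct C (in_arcs G w) (\<lambda>e. D_obj D (tail G e)) (D_obj D w) (D_arr D)"
      using D by (simp add: coproduct_condition_restrict_iff)
    show "T w \<in> Hom C (D_obj D w) (D_obj E w)" "U w \<in> Hom C (D_obj D w) (D_obj E w)"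
      using T U w by (auto simp: is_diagram_morphism_def)
    fix e assume e: "e \<in> in_arcs G w"
    then have "Comp C (T w) (D_arr D e) = Comp C (D_arr E e) (T (tail G e))"
      "Comp C (U w) (D_arr D e) = Comp C (D_arr E e) (U (tail G e))"
      using T U by (auto simp: is_diagram_morphism_def)
    then show "Comp C (T w) (D_arr D e) = Comp C (U w) (D_arr D e)"
      using off_w[of "tail G e"] e by (simp add: tail_noteq_sink)
  qed unfold_locales
  then have "T v = U v" if "v \<in> verts G" for v
    using off_w that by blast
  moreover have "T \<in> extensional (verts G)" "U \<in> extensional (verts G)"
    using T U by (auto simp: is_diagram_morphism_def PiE_iff)
  ultimately show "f = g"
    unfolding f g by (metis extensionalityI)
qed

text \<open>Conversely, the universal property at \<open>w\<close> supplies the missing component, and each new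
  square is one of the equations that characterize it.\<close>

lemma restrict_arrow_surj:
  assumes D: "D \<in> Obj (Diag_coprod C G)" and E: "E \<in> Obj (Diag_coprod C G)"
    and g: "g \<in> Hom (Diag_coprod C H) (restrict_diagram H D) (restrict_diagram H E)"
  shows "g \<in> restrict_arrow H ` Hom (Diag_coprod C G) D E"
proof -
  have D': "is_diagram C G D" "coproduct_condition C G D"
    and E': "is_diagram C G E" "coproduct_condition C G E"
    using D E by (auto simp: Diag_coprod_def)
  obtain S where g: "g = (restrict_diagram H D, S, restrict_diagram H E)"
    and S: "is_diagram_morphism C H (restrict_diagram H D) (restrict_diagram H E) S"
    using g by (auto simp: Hom_Diag_coprod)
  have S_Hom: "S v \<in> Hom C (D_obj D v) (D_obj E v)" if "v \<in> verts G" "v \<noteq> w" for v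
    using S that by (auto simp: is_diagram_morphism_def restrict_diagram_def PiE_iff)
  have S_comm: "Comp C (S (head G e)) (D_arr D e) = Comp C (D_arr E e) (S (tail G e))"
    if "e \<in> arcs G" "head G e \<noteq> w" for e
    using S that by (auto simp: is_diagram_morphism_def restrict_diagram_def)
  have S_ext: "S \<in> extensional (verts G - {w})"
    using S by (auto simp: is_diagram_morphism_def PiE_iff)
  have cop: "is_coproduct C (in_arcs G w) (\<lambda>e. D_obj D (tail G e)) (D_obj D w) (D_arr D)"
    using D' by (simp add: coproduct_condition_restrict_iff)
  have Ew: "D_obj E w \<in> Obj C" using E'(1) w by (auto simp: is_diagram_def)
  have cocone: "Comp C (D_arr E e) (S (tail G e)) \<in> Hom C (D_obj D (tail G e)) (D_obj E w)"
    if "e \<in> in_arcs G w" for e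
  proof (rule Comp_in_Hom)
    show "S (tail G e) \<in> Hom C (D_obj D (tail G e)) (D_obj E (tail G e))"
      using that by (intro S_Hom) (auto simp: tail_noteq_sink)
    show "D_arr E e \<in> Hom C (D_obj E (tail G e)) (D_obj E w)"
      using that E'(1) by (auto simp: is_diagram_def)
  qed
  obtain h where h: "h \<in> Hom C (D_obj D w) (D_obj E w)"
    "\<And>e. e \<in> in_arcs G w \<Longrightarrow> Comp C h (D_arr D e) = Comp C (D_arr E e) (S (tail G e))"
    by (rule coproduct_mediating_exists[OF cop Ew, of "\<lambda>e. Comp C (D_arr E e) (S (tail G e))"])
      (use cocone in auto)
  have "is_diagram_morphism C G D E (S(w := h))"
    unfolding is_diagram_morphism_def
  proof (intro conjI ballI PiE_I)
    fix e assume e: "e \<in> arcs G"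
    then show "Comp C ((S(w := h)) (head G e)) (D_arr D e) =
          Comp C (D_arr E e) ((S(w := h)) (tail G e))"
      using h(2)[of e] S_comm[of e] by (auto simp: tail_noteq_sink)
  qed (use w h(1) S_Hom S_ext in \<open>auto simp: extensional_def\<close>)
  then have "(D, S(w := h), E) \<in> Hom (Diag_coprod C G) D E"
    using D' E' by (simp add: Hom_Diag_coprod)
  moreover have "g = restrict_arrow H (D, S(w := h), E)"
    using S_ext by (auto simp: g restrict_def extensional_def fun_eq_iff)
  ultimately show ?thesis by blast
qed

text \<open>A coproduct put at \<open>w\<close> cannot spoil the condition at another vertex, as no arc leaves
  \<open>w\<close>. Extensionality makes the restriction of the extended diagram equal to \<open>D\<close>, and not only
  isomorphic to it.\<close>

lemma extension_to_sink:
  assumes cops: "\<And>X. \<forall>e\<in>in_arcs G w. X e \<in> Obj C \<Longrightarrow> \<exists>c \<iota>. is_coproduct C (in_arcs G w) X c \<iota>"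
    and D: "D \<in> Obj (Diag_coprod C H)"
  shows "D \<in> restrict_diagram H ` Obj (Diag_coprod C G)"
proof -
  have D': "is_diagram C H D" "coproduct_condition C H D"
    using D by (auto simp: Diag_coprod_def)
  have obj: "D_obj D v \<in> Obj C" if "v \<in> verts G" "v \<noteq> w" for v
    using D'(1) that by (auto simp: is_diagram_def PiE_iff)
  have "\<forall>e\<in>in_arcs G w. D_obj D (tail G e) \<in> Obj C"
    by (intro ballI obj) (simp_all add: tail_noteq_sink)
  from cops[OF this] obtain c \<iota>
    where c: "is_coproduct C (in_arcs G w) (\<lambda>e. D_obj D (tail G e)) c \<iota>" by blast
  define E where "E = \<lparr> D_obj = (D_obj D)(w := c),
    D_arr = (\<lambda>e. if e \<in> in_arcs G w then \<iota> e else D_arr D e) \<rparr>"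
  have restrict_E: "restrict_diagram H E = D"
    using D'(1) unfolding restrict_diagram_def E_def is_diagram_def
    by (intro diagram.equality) (auto simp: PiE_iff extensional_def restrict_def fun_eq_iff)
  have "is_diagram C G E"
    using D'(1) is_coproductD[OF c] w unfolding is_diagram_def E_def
    by (auto simp: PiE_iff extensional_def tail_noteq_sink)
  moreover have "is_coproduct C (in_arcs G w) (\<lambda>e. D_obj E (tail G e)) (D_obj E w) (D_arr E)"
    using c by (subst is_coproduct_cong) (auto simp: E_def tail_noteq_sink)
  ultimately have "E \<in> Obj (Diag_coprod C G)"
    using D'(2) by (simp add: Diag_coprod_def coproduct_condition_restrict_iff restrict_E)
  then show ?thesis using restrict_E by blast
qed

lemma equivalent_Diag_coprod:
  assumes "\<And>X. \<forall>e\<in>in_arcs G w. X e \<in> Obj C \<Longrightarrow> \<exists>c \<iota>. is_coproduct C (in_arcs G w) X c \<iota>"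
  shows "equivalent_categories (Diag_coprod C G) (Diag_coprod C H)"
proof (rule equivalence_criterion[OF _ _ is_functor_restrict])
  show "category (Diag_coprod C G)" "category (Diag_coprod C H)"
    using category_Diag_coprod wf_H category_axioms wf_digraph_axioms by blast+
qed (use restrict_arrow_inj restrict_arrow_surj extension_to_sink[OF assms] in blast)+

end

section \<open>The equivalence\<close>

theorem theorem4p2:
  fixes G :: "('v, 'e) pre_digraph" and w :: 'v
  assumes "directed_graph G" and "w \<in> verts G" and "is_sink G w" and "\<not> is_source G w"
  shows "(\<forall>C :: ('o, 'm) cat. category C \<longrightarrow> has_nonempty_coproducts TYPE('e) C \<longrightarrow>
            equivalent_categories (Diag_coprod C G) (Diag_coprod C (remove_sink G w))) \<and>
         (\<not> infinite_receiver G w \<longrightarrow>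
            (\<forall>C :: ('o, 'm) cat. category C \<longrightarrow> has_binary_coproducts C \<longrightarrow>
               equivalent_categories (Diag_coprod C G) (Diag_coprod C (remove_sink G w))))"
proof (intro conjI allI impI)
  have loc: "nonsource_sink G w C" if "category C" for C :: "('o, 'm) cat"
    using assms that
    by (simp add: nonsource_sink_def nonsource_sink_axioms_def directed_graph_def)
  have nonempty: "in_arcs G w \<noteq> {}" using assms(4) by (simp add: is_source_def)
  fix C :: "('o, 'm) cat" assume C: "category C"
  show "equivalent_categories (Diag_coprod C G) (Diag_coprod C (remove_sink G w))"
    if "has_nonempty_coproducts TYPE('e) C"
    using that nonempty
    by (intro nonsource_sink.equivalent_Diag_coprod[OF loc[OF C]])
      (simp add: has_nonempty_coproducts_def)
  show "equivalent_categories (Diag_coprod C G) (Diag_coprod C (remove_sink G w))"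
    if "\<not> infinite_receiver G w" "has_binary_coproducts C"
    using that nonempty
    by (intro nonsource_sink.equivalent_Diag_coprod[OF loc[OF C]] finite_coproducts[OF C])
      (simp_all add: infinite_receiver_def)
qed

end
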